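(* Let $L\mathfrak{so}(4)$ be the Lie algebra of smooth free loops in $\mathfrak{so}(4)$. The map $\alpha:L\mathfrak{so}(4)\times L\mathfrak{so}(4)\to\mathbb R$ given by $$\alpha(\xi_1,\xi_2)=\frac{-1}{128\pi^2}\sum_{\tau\in\mathfrak S_4}\mathrm{sgn}(\tau)\int_0^1\left(\left(\frac{\partial\xi_1(\theta)}{\partial\theta}\right)_{\tau(1)\tau(2)}\xi_2(\theta)_{\tau(3)\tau(4)}-\left(\frac{\partial\xi_2(\theta)}{\partial\theta}\right)_{\tau(1)\tau(2)}\xi_1(\theta)_{\tau(3)\tau(4)}\right)d\theta$$ is a Lie algebra $2$-cocycle on $L\mathfrak{so}(4)$.
   Context: $\mathfrak{so}(4)$ is the Lie algebra of real antisymmetric $4\times4$ matrices. $L\mathfrak{so}(4)$ is the space of smooth maps $\xi:S^1=\mathbb R/\mathbb Z\to\mathfrak{so}(4)$ with the pointwise Lie bracket and the $C^\infty$ topology. $A_{ab}$ denotes the $(a,b)$ entry of the matrix $A$; $\mathfrak S_4$ is the symmetric group on $\{1,2,3,4\}$. A Lie algebra $2$-cocycle on a Lie algebra $\mathcal G$ (trivial real coefficients) is a smooth alternating bilinear map $\alpha:\mathcal G\times\mathcal G\to\mathbb R$ with $\alpha([\xi_1,\xi_2],\xi_3)+\alpha([\xi_2,\xi_3],\xi_1)+\alpha([\xi_3,\xi_1],\xi_2)=0$ for all $\xi_1,\xi_2,\xi_3\in\mathcal G$. *)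

theory Defs
  imports "HOL-Analysis.Analysis" "HOL-Combinatorics.Permutations"
begin

section \<open>Lie algebras and smooth 2-cocycles\<close>

class real_lie_algebra = real_vector +
  fixes lie_bracket :: "'a \<Rightarrow> 'a \<Rightarrow> 'a"
  assumes lie_bracket_add_left: "lie_bracket (x + y) z = lie_bracket x z + lie_bracket y z"
    and lie_bracket_add_right: "lie_bracket x (y + z) = lie_bracket x y + lie_bracket x z"
    and lie_bracket_scaleR_left: "lie_bracket (r *\<^sub>R x) y = r *\<^sub>R lie_bracket x y"
    and lie_bracket_scaleR_right: "lie_bracket x (r *\<^sub>R y) = r *\<^sub>R lie_bracket x y"
    and lie_bracket_self: "lie_bracket x x = 0"
    and lie_bracket_jacobi: "lie_bracket x (lie_bracket y z) + lie_bracket y (lie_bracket z x)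
          + lie_bracket z (lie_bracket x y) = 0"

text \<open>
  Smoothness of maps on spaces that are not normed is meant in the sense of Michal, Bastiani
  and Hamilton: all iterated directional derivatives
  $d^k f(x; v_0, \ldots, v_{k-1})$ exist and are jointly continuous.
  Directions are packed into a sequence \<open>v :: nat \<Rightarrow> 'a\<close> with the product topology;
  \<open>iter_dir_deriv f k x v\<close> depends only on the first \<open>k\<close> entries of \<open>v\<close>, so
  joint continuity in \<open>(x, v)\<close> is the same as continuity on the product of \<open>k + 1\<close> copies
  of the space.
\<close>

primrec iter_dir_deriv ::
  "('a::real_vector \<Rightarrow> 'b::real_normed_vector) \<Rightarrow> nat \<Rightarrow> 'a \<Rightarrow> (nat \<Rightarrow> 'a) \<Rightarrow> 'b" where
  "iter_dir_deriv f 0 x v = f x"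
| "iter_dir_deriv f (Suc k) x v =
     vector_derivative (\<lambda>t. iter_dir_deriv f k (x + t *\<^sub>R v k) v) (at 0)"

definition smooth_map ::
  "('a::{real_vector,topological_space} \<Rightarrow> 'b::real_normed_vector) \<Rightarrow> bool" where
  "smooth_map f \<longleftrightarrow>
     (\<forall>k. (\<forall>x v. (\<lambda>t. iter_dir_deriv f k (x + t *\<^sub>R v k) v) differentiable (at (0::real))) \<and>
          continuous_on UNIV (\<lambda>(x, v). iter_dir_deriv f k x v))"

definition lie_2_cocycle ::
  "('a::{real_lie_algebra,topological_space} \<Rightarrow> 'a \<Rightarrow> real) \<Rightarrow> bool" where
  "lie_2_cocycle \<alpha> \<longleftrightarrow>
     smooth_map (\<lambda>(x, y). \<alpha> x y) \<and>
     bilinear \<alpha> \<and>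
     (\<forall>x. \<alpha> x x = 0) \<and>
     (\<forall>x y z. \<alpha> (lie_bracket x y) z + \<alpha> (lie_bracket y z) x + \<alpha> (lie_bracket z x) y = 0)"


section \<open>Smooth curves\<close>

definition higher_vderiv :: "nat \<Rightarrow> (real \<Rightarrow> 'b::real_normed_vector) \<Rightarrow> real \<Rightarrow> 'b" where
  "higher_vderiv k = (\<lambda>f \<theta>. vector_derivative f (at \<theta>)) ^^ k"

definition smooth_curve :: "(real \<Rightarrow> 'b::real_normed_vector) \<Rightarrow> bool" where
  "smooth_curve f \<longleftrightarrow> (\<forall>k \<theta>. higher_vderiv k f differentiable (at \<theta>))"

lemma higher_vderiv_0 [simp]: "higher_vderiv 0 f = f"
  by (simp add: higher_vderiv_def)

lemma higher_vderiv_Suc: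
  "higher_vderiv (Suc k) f = higher_vderiv k (\<lambda>\<theta>. vector_derivative f (at \<theta>))"
  by (simp add: higher_vderiv_def funpow_Suc_right del: funpow.simps)

definition Ck_curve :: "nat \<Rightarrow> (real \<Rightarrow> 'b::real_normed_vector) \<Rightarrow> bool" where
  "Ck_curve k f \<longleftrightarrow> (\<forall>j<k. \<forall>\<theta>. higher_vderiv j f differentiable (at \<theta>))"

lemma smooth_curve_iff_Ck: "smooth_curve f \<longleftrightarrow> (\<forall>k. Ck_curve k f)"
  unfolding smooth_curve_def Ck_curve_def by auto

lemma Ck_curve_0 [simp]: "Ck_curve 0 f"
  by (simp add: Ck_curve_def)

lemma Ck_curve_Suc:
  "Ck_curve (Suc k) f \<longleftrightarrow>
     (\<forall>\<theta>. f differentiable (at \<theta>)) \<and> Ck_curve k (\<lambda>\<theta>. vector_derivative f (at \<theta>))"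
  unfolding Ck_curve_def
  by (auto simp: less_Suc_eq_0_disj higher_vderiv_Suc)

lemma Ck_curve_mono: "Ck_curve (Suc k) f \<Longrightarrow> Ck_curve k f"
  unfolding Ck_curve_def by auto

lemma vderiv_eqI:
  assumes "\<And>\<theta>. (f has_vector_derivative f' \<theta>) (at \<theta>)"
  shows "(\<lambda>\<theta>. vector_derivative f (at \<theta>)) = f'"
  using assms by (auto simp: vector_derivative_at)

lemma Ck_curve_SucI:
  assumes "\<And>\<theta>. (f has_vector_derivative f' \<theta>) (at \<theta>)" and "Ck_curve k f'"
  shows "Ck_curve (Suc k) f"
  using assms vderiv_eqI[of f f'] unfolding Ck_curve_Suc
  by (metis differentiableI_vector)

lemma Ck_curve_SucD:
  assumes "Ck_curve (Suc k) f"
  shows "(f has_vector_derivative vector_derivative f (at \<theta>)) (at \<theta>)"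
  using assms by (simp add: Ck_curve_Suc vector_derivative_works)

lemma Ck_curve_const: "Ck_curve k (\<lambda>_. c)"
proof (induction k arbitrary: c)
  case (Suc k)
  show ?case by (rule Ck_curve_SucI[where f' = "\<lambda>_. 0"]) (auto simp: Suc)
qed simp

lemma Ck_curve_add: "Ck_curve k f \<Longrightarrow> Ck_curve k g \<Longrightarrow> Ck_curve k (\<lambda>\<theta>. f \<theta> + g \<theta>)"
proof (induction k arbitrary: f g)
  case (Suc k)
  show ?case
    by (rule Ck_curve_SucI[OF has_vector_derivative_add[OF Suc.prems[THEN Ck_curve_SucD]]])
       (use Suc in \<open>auto simp: Ck_curve_Suc\<close>)
qed simp

lemma Ck_curve_bilinear:
  assumes "bounded_bilinear b"
  shows "Ck_curve k f \<Longrightarrow> Ck_curve k g \<Longrightarrow> Ck_curve k (\<lambda>\<theta>. b (f \<theta>) (g \<theta>))"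
proof (induction k arbitrary: f g)
  case (Suc k)
  show ?case
  proof (rule Ck_curve_SucI)
    show "((\<lambda>\<theta>. b (f \<theta>) (g \<theta>)) has_vector_derivative
        b (f \<theta>) (vector_derivative g (at \<theta>)) + b (vector_derivative f (at \<theta>)) (g \<theta>)) (at \<theta>)" for \<theta>
      by (rule bounded_bilinear.has_vector_derivative[OF assms Suc.prems[THEN Ck_curve_SucD]])
    show "Ck_curve k (\<lambda>\<theta>. b (f \<theta>) (vector_derivative g (at \<theta>)) + b (vector_derivative f (at \<theta>)) (g \<theta>))"
      using Suc.prems Suc.prems[THEN Ck_curve_mono]
      by (intro Ck_curve_add Suc.IH) (auto simp: Ck_curve_Suc)
  qed
qed simp

lemma smooth_curve_const: "smooth_curve (\<lambda>_. c)"
  by (simp add: smooth_curve_iff_Ck Ck_curve_const)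

lemma smooth_curve_add:
  "smooth_curve f \<Longrightarrow> smooth_curve g \<Longrightarrow> smooth_curve (\<lambda>\<theta>. f \<theta> + g \<theta>)"
  by (simp add: smooth_curve_iff_Ck Ck_curve_add)

lemma smooth_curve_bilinear:
  "bounded_bilinear b \<Longrightarrow> smooth_curve f \<Longrightarrow> smooth_curve g \<Longrightarrow> smooth_curve (\<lambda>\<theta>. b (f \<theta>) (g \<theta>))"
  by (simp add: smooth_curve_iff_Ck Ck_curve_bilinear)

lemma smooth_curve_scaleR: "smooth_curve f \<Longrightarrow> smooth_curve (\<lambda>\<theta>. r *\<^sub>R f \<theta>)"
  by (rule smooth_curve_bilinear[OF bounded_bilinear_scaleR smooth_curve_const])

lemma smooth_curve_uminus: "smooth_curve f \<Longrightarrow> smooth_curve (\<lambda>\<theta>. - f \<theta>)"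
  using smooth_curve_scaleR[of f "- 1"] by simp

lemma smooth_curve_diff:
  "smooth_curve f \<Longrightarrow> smooth_curve g \<Longrightarrow> smooth_curve (\<lambda>\<theta>. f \<theta> - g \<theta>)"
  using smooth_curve_add[OF _ smooth_curve_uminus, of f g] by simp


section \<open>The loop algebra of \<open>so(4)\<close>\<close>

text \<open>
  Matrix indices range over the type \<open>4\<close>, whose elements are \<open>1, 2, 3, 4\<close> (with \<open>4 = 0\<close>).
\<close>

definition so4 :: "(real^4^4) set" where
  "so4 = {A. transpose A = - A}"

lemma so4_iff: "A \<in> so4 \<longleftrightarrow> (\<forall>a b. A $ a $ b = - A $ b $ a)"
  unfolding so4_def transpose_def by (auto simp: vec_eq_iff)

text \<open>Maps on the circle $\mathbb{R}/\mathbb{Z}$ are maps on the line of period 1.\<close>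

typedef loop_so4 =
  "{\<xi> :: real \<Rightarrow> real^4^4. smooth_curve \<xi> \<and> (\<forall>\<theta>. \<xi> (\<theta> + 1) = \<xi> \<theta>) \<and> (\<forall>\<theta>. \<xi> \<theta> \<in> so4)}"
  morphisms loop_val Abs_loop_so4
  by (rule exI[of _ "\<lambda>_. 0"]) (simp add: smooth_curve_const so4_iff)

lemma loop_val_smooth: "smooth_curve (loop_val \<xi>)"
  and loop_val_period: "loop_val \<xi> (\<theta> + 1) = loop_val \<xi> \<theta>"
  and loop_val_so4: "loop_val \<xi> \<theta> \<in> so4"
  using loop_val[of \<xi>] by auto

lemma loop_so4_eq_iff: "\<xi> = \<eta> \<longleftrightarrow> (\<forall>\<theta>. loop_val \<xi> \<theta> = loop_val \<eta> \<theta>)"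
  by (metis loop_val_inject ext)

lemma bounded_bilinear_matrix_mult: "bounded_bilinear ((**) :: real^4^4 \<Rightarrow> real^4^4 \<Rightarrow> real^4^4)"
  by (rule bilinear_conv_bounded_bilinear[THEN iffD1])
     (auto simp: bilinear_def linear_iff matrix_matrix_mult_def vec_eq_iff
        sum.distrib sum_distrib_left algebra_simps)

lemma so4_zero: "0 \<in> so4"
  by (simp add: so4_iff)

lemma so4_add: "A \<in> so4 \<Longrightarrow> B \<in> so4 \<Longrightarrow> A + B \<in> so4"
  unfolding so4_iff vector_add_component by (metis minus_add_distrib)

lemma so4_scaleR: "A \<in> so4 \<Longrightarrow> r *\<^sub>R A \<in> so4"
  unfolding so4_iff vector_scaleR_component by (metis scaleR_minus_right)

lemma so4_uminus: "A \<in> so4 \<Longrightarrow> - A \<in> so4"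
  using so4_scaleR[of A "- 1"] by simp

lemma so4_diff: "A \<in> so4 \<Longrightarrow> B \<in> so4 \<Longrightarrow> A - B \<in> so4"
  using so4_add[OF _ so4_uminus, of A B] by simp

lemma so4_commutator: "A \<in> so4 \<Longrightarrow> B \<in> so4 \<Longrightarrow> A ** B - B ** A \<in> so4"
  unfolding so4_def mem_Collect_eq
proof -
  note bb = bounded_bilinear_matrix_mult
  assume "transpose A = - A" "transpose B = - B"
  then have "transpose (A ** B) = B ** A" "transpose (B ** A) = A ** B"
    by (simp_all add: matrix_transpose_mul bounded_bilinear.minus_left[OF bb]
        bounded_bilinear.minus_right[OF bb])
  then show "transpose (A ** B - B ** A) = - (A ** B - B ** A)"
    by (simp add: transpose_def vec_eq_iff)
qed

instantiation loop_so4 :: real_lie_algebra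
begin

definition "(0 :: loop_so4) = Abs_loop_so4 (\<lambda>_. 0)"
definition "\<xi> + \<eta> = Abs_loop_so4 (\<lambda>\<theta>. loop_val \<xi> \<theta> + loop_val \<eta> \<theta>)"
definition "- \<xi> = Abs_loop_so4 (\<lambda>\<theta>. - loop_val \<xi> \<theta>)"
definition "\<xi> - \<eta> = Abs_loop_so4 (\<lambda>\<theta>. loop_val \<xi> \<theta> - loop_val \<eta> \<theta>)"
definition "r *\<^sub>R \<xi> = Abs_loop_so4 (\<lambda>\<theta>. r *\<^sub>R loop_val \<xi> \<theta>)"
definition "lie_bracket \<xi> \<eta> =
  Abs_loop_so4 (\<lambda>\<theta>. loop_val \<xi> \<theta> ** loop_val \<eta> \<theta> - loop_val \<eta> \<theta> ** loop_val \<xi> \<theta>)"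

lemma loop_val_ops:
  "loop_val 0 = (\<lambda>_. 0)"
  "loop_val (\<xi> + \<eta>) = (\<lambda>\<theta>. loop_val \<xi> \<theta> + loop_val \<eta> \<theta>)"
  "loop_val (- \<xi>) = (\<lambda>\<theta>. - loop_val \<xi> \<theta>)"
  "loop_val (\<xi> - \<eta>) = (\<lambda>\<theta>. loop_val \<xi> \<theta> - loop_val \<eta> \<theta>)"
  "loop_val (r *\<^sub>R \<xi>) = (\<lambda>\<theta>. r *\<^sub>R loop_val \<xi> \<theta>)"
  "loop_val (lie_bracket \<xi> \<eta>) =
     (\<lambda>\<theta>. loop_val \<xi> \<theta> ** loop_val \<eta> \<theta> - loop_val \<eta> \<theta> ** loop_val \<xi> \<theta>)"
proof -
  note [simp] = loop_val_smooth loop_val_period loop_val_so4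
    smooth_curve_const smooth_curve_add smooth_curve_uminus smooth_curve_diff smooth_curve_scaleR
    smooth_curve_bilinear[OF bounded_bilinear_matrix_mult]
    so4_zero so4_add so4_uminus so4_diff so4_scaleR so4_commutator
  show "loop_val 0 = (\<lambda>_. 0)"
    unfolding zero_loop_so4_def by (rule Abs_loop_so4_inverse) simp
  show "loop_val (\<xi> + \<eta>) = (\<lambda>\<theta>. loop_val \<xi> \<theta> + loop_val \<eta> \<theta>)"
    unfolding plus_loop_so4_def by (rule Abs_loop_so4_inverse) simp
  show "loop_val (- \<xi>) = (\<lambda>\<theta>. - loop_val \<xi> \<theta>)"
    unfolding uminus_loop_so4_def by (rule Abs_loop_so4_inverse) simp
  show "loop_val (\<xi> - \<eta>) = (\<lambda>\<theta>. loop_val \<xi> \<theta> - loop_val \<eta> \<theta>)"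
    unfolding minus_loop_so4_def by (rule Abs_loop_so4_inverse) simp
  show "loop_val (r *\<^sub>R \<xi>) = (\<lambda>\<theta>. r *\<^sub>R loop_val \<xi> \<theta>)"
    unfolding scaleR_loop_so4_def by (rule Abs_loop_so4_inverse) simp
  show "loop_val (lie_bracket \<xi> \<eta>) =
     (\<lambda>\<theta>. loop_val \<xi> \<theta> ** loop_val \<eta> \<theta> - loop_val \<eta> \<theta> ** loop_val \<xi> \<theta>)"
    unfolding lie_bracket_loop_so4_def by (rule Abs_loop_so4_inverse) simp
qed

instance
proof
  note bb = bounded_bilinear_matrix_mult
  note mm = bounded_bilinear.add_left[OF bb] bounded_bilinear.add_right[OF bb]
    bounded_bilinear.diff_left[OF bb] bounded_bilinear.diff_right[OF bb]
    bounded_bilinear.scaleR_left[OF bb] bounded_bilinear.scaleR_right[OF bb]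
  note simps = loop_so4_eq_iff loop_val_ops mm matrix_mul_assoc
  fix x y z :: loop_so4 and r s :: real
  show "x + y + z = x + (y + z)" by (simp add: simps)
  show "x + y = y + x" by (simp add: simps add.commute)
  show "0 + x = x" by (simp add: simps)
  show "- x + x = 0" by (simp add: simps)
  show "x - y = x + - y" by (simp add: simps)
  show "r *\<^sub>R (x + y) = r *\<^sub>R x + r *\<^sub>R y" by (simp add: simps scaleR_add_right)
  show "(r + s) *\<^sub>R x = r *\<^sub>R x + s *\<^sub>R x" by (simp add: simps scaleR_add_left)
  show "r *\<^sub>R s *\<^sub>R x = (r * s) *\<^sub>R x" by (simp add: simps)
  show "1 *\<^sub>R x = x" by (simp add: simps)
  show "lie_bracket (x + y) z = lie_bracket x z + lie_bracket y z" by (simp add: simps)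
  show "lie_bracket x (y + z) = lie_bracket x y + lie_bracket x z" by (simp add: simps)
  show "lie_bracket (r *\<^sub>R x) y = r *\<^sub>R lie_bracket x y" by (simp add: simps scaleR_diff_right)
  show "lie_bracket x (r *\<^sub>R y) = r *\<^sub>R lie_bracket x y" by (simp add: simps scaleR_diff_right)
  show "lie_bracket x x = 0" by (simp add: simps)
  show "lie_bracket x (lie_bracket y z) + lie_bracket y (lie_bracket z x)
          + lie_bracket z (lie_bracket x y) = 0" by (simp add: simps)
qed

end

text \<open>
  The \<open>C\<^sup>\<infinity>\<close> topology: uniform convergence of every derivative, given by the
  neighbourhood bases $\{\eta \mid \sup_\theta |\eta^{(k)}(\theta) - \xi^{(k)}(\theta)| \le e, \ k \le n\}$
  with \<open>e > 0\<close>.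
\<close>

instantiation loop_so4 :: topological_space
begin

definition open_loop_so4_def:
  "open (U :: loop_so4 set) \<longleftrightarrow>
     (\<forall>\<xi>\<in>U. \<exists>n. \<exists>e>0. \<forall>\<eta>.
        (\<forall>k\<le>n. \<forall>\<theta>. norm (higher_vderiv k (loop_val \<eta>) \<theta> - higher_vderiv k (loop_val \<xi>) \<theta>) \<le> e)
          \<longrightarrow> \<eta> \<in> U)"

instance
proof
  show "open (UNIV :: loop_so4 set)"
    unfolding open_loop_so4_def by (auto intro: exI[of _ 1])
next
  fix U V :: "loop_so4 set"
  assume U: "open U" and V: "open V"
  show "open (U \<inter> V)"
    unfolding open_loop_so4_def
  proof
    fix \<xi> assume "\<xi> \<in> U \<inter> V"
    let ?P = "\<lambda>n e W. \<forall>\<eta>. (\<forall>k\<le>n. \<forall>\<theta>. norm (higher_vderiv k (loop_val \<eta>) \<theta>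
        - higher_vderiv k (loop_val \<xi>) \<theta>) \<le> e) \<longrightarrow> \<eta> \<in> W"
    obtain n e where 1: "e > 0" "?P n e U"
      using U \<open>\<xi> \<in> U \<inter> V\<close> unfolding open_loop_so4_def by blast
    obtain m d where 2: "d > 0" "?P m d V"
      using V \<open>\<xi> \<in> U \<inter> V\<close> unfolding open_loop_so4_def by blast
    have "?P (max n m) (min e d) (U \<inter> V)"
      using 1(2) 2(2) by (simp add: le_max_iff_disj)
    then show "\<exists>n. \<exists>e>0. ?P n e (U \<inter> V)"
      using 1(1) 2(1) by (metis min_less_iff_conj)
  qed
next
  fix K :: "loop_so4 set set"
  assume "\<forall>U\<in>K. open U"
  then show "open (\<Union>K)"
    unfolding open_loop_so4_def by (meson Union_iff)
qed

end

end

theory Submission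
  imports Defs
begin

text \<open>
  The signed sum over permutations is a symmetric bilinear form \<open>P\<close> on \<open>so(4)\<close> (the polarised
  Pfaffian) for which \<open>P([A, B], C)\<close> is invariant under cyclic shifts. Hence the
  cyclic sum of the integrands \<open>P([x, y]', z) - P(z', [x, y])\<close> equals the derivative of the
  periodic function \<open>P([x, y], z)\<close>, and its integral over a period vanishes. The form
  is bounded by the \<open>C\<^sup>1\<close> norms of its arguments, so it is continuous; being bilinear, it is then
  smooth, as its directional derivatives of order three and higher are zero.
\<close>

section \<open>Continuous bilinear maps are smooth\<close>

text \<open>Along a line \<open>b\<close> is a quadratic polynomial in the parameter, so every
  iterated derivative has an explicit formula. Each is a sum of values of \<open>b\<close> at
  components of the base point and the directions; the additions take place in the normed target, so
  continuity reduces to that of \<open>b\<close> and of the projections.\<close>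

lemma smooth_map_bilinear:
  fixes b :: "'a::{real_vector,topological_space} \<Rightarrow> 'b::{real_vector,topological_space} \<Rightarrow> 'c::real_normed_vector"
  assumes b: "bilinear b" and cont: "continuous_on UNIV (\<lambda>(x, y). b x y)"
  shows "smooth_map (\<lambda>(x, y). b x y)"
proof -
  define f where "f = (\<lambda>(x, y). b x y)"
  have f: "f p = b (fst p) (snd p)" for p
    by (simp add: f_def case_prod_unfold)
  have add: "b (x + x') y = b x y + b x' y" "b x (y + y') = b x y + b x y'" for x x' y y'
    using b by (auto simp: bilinear_def linear_iff)
  have scale: "b (r *\<^sub>R x) y = r *\<^sub>R b x y" "b x (r *\<^sub>R y) = r *\<^sub>R b x y" for r x y
    using b by (auto simp: bilinear_def linear_iff)
  have D0: "((\<lambda>t. f (p + t *\<^sub>R q)) has_vector_derivative b (fst p) (snd q) + b (fst q) (snd p)) (at 0)"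
    for p q :: "'a \<times> 'b"
  proof -
    \<comment> \<open>The bilinear expansion of \<open>f\<close> at the shifted point, ordered by
      powers of \<open>t\<close>; the derivative at 0 is the coefficient of
      \<open>t\<close>.\<close>
    have "((\<lambda>t. b (fst p) (snd p) + t *\<^sub>R (b (fst p) (snd q) + b (fst q) (snd p))
        + (t * t) *\<^sub>R b (fst q) (snd q)) has_vector_derivative
        b (fst p) (snd q) + b (fst q) (snd p)) (at 0)"
      by (auto intro!: derivative_eq_intros)
    then show ?thesis
      by (simp add: f add scale algebra_simps)
  qed
  have 1: "iter_dir_deriv f (Suc 0) p v = b (fst p) (snd (v 0)) + b (fst (v 0)) (snd p)" for p v
    using vector_derivative_at[OF D0] by simp
  have D1: "((\<lambda>t. iter_dir_deriv f (Suc 0) (p + t *\<^sub>R q) v) has_vector_derivative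
      b (fst q) (snd (v 0)) + b (fst (v 0)) (snd q)) (at 0)" for p q v
  proof -
    have "((\<lambda>t. (b (fst p) (snd (v 0)) + b (fst (v 0)) (snd p))
        + t *\<^sub>R (b (fst q) (snd (v 0)) + b (fst (v 0)) (snd q))) has_vector_derivative
        b (fst q) (snd (v 0)) + b (fst (v 0)) (snd q)) (at 0)"
      by (auto intro!: derivative_eq_intros)
    then show ?thesis
      unfolding 1 by (simp add: add scale algebra_simps)
  qed
  have 2: "iter_dir_deriv f (Suc (Suc 0)) p v =
      b (fst (v 1)) (snd (v 0)) + b (fst (v 0)) (snd (v 1))" for p v
    using vector_derivative_at[OF D1] by simp
  \<comment> \<open>By \<open>2\<close> the second derivative is constant in the base point, which
    gives order three; the higher orders differentiate zero.\<close>
  have 3: "iter_dir_deriv f (Suc (Suc (Suc k))) p v = 0" for k p v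
    by (induction k arbitrary: p)
       (subst iter_dir_deriv.simps, simp only: 2 vector_derivative_const_at, simp)
  have contb: "continuous_on UNIV (\<lambda>q. b (g q) (h q))"
    if "continuous_on UNIV g" "continuous_on UNIV h"
    for g :: "('a \<times> 'b) \<times> (nat \<Rightarrow> 'a \<times> 'b) \<Rightarrow> 'a" and h
    using continuous_on_compose2[OF cont continuous_on_Pair[OF that]] by simp
  have coord: "continuous_on UNIV (\<lambda>q :: ('a \<times> 'b) \<times> (nat \<Rightarrow> 'a \<times> 'b). snd q n)" for n
    by (rule continuous_on_compose2[OF continuous_on_product_coordinates])
       (auto intro: continuous_intros)
  note cont_intros = continuous_on_add contb continuous_on_fst continuous_on_snd coord continuous_on_id
  show ?thesis
    unfolding smooth_map_def f_def[symmetric]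
  proof (intro allI)
    fix k
    consider "k = 0" | "k = Suc 0" | "k = Suc (Suc 0)" | j where "k = Suc (Suc (Suc j))"
      by (metis not0_implies_Suc)
    then show "(\<forall>p v. (\<lambda>t. iter_dir_deriv f k (p + t *\<^sub>R v k) v) differentiable at 0) \<and>
       continuous_on UNIV (\<lambda>(p, v). iter_dir_deriv f k p v)"
    proof cases
      case 1
      have "continuous_on UNIV (\<lambda>q :: ('a \<times> 'b) \<times> (nat \<Rightarrow> 'a \<times> 'b). b (fst (fst q)) (snd (fst q)))"
        by (intro cont_intros)
      with 1 show ?thesis
        using differentiableI_vector[OF D0] by (simp add: case_prod_unfold f)
    next
      case k: 2
      have "continuous_on UNIV (\<lambda>q :: ('a \<times> 'b) \<times> (nat \<Rightarrow> 'a \<times> 'b).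
          b (fst (fst q)) (snd (snd q 0)) + b (fst (snd q 0)) (snd (fst q)))"
        by (intro cont_intros)
      then show ?thesis
        using differentiableI_vector[OF D1] unfolding k case_prod_unfold 1 by blast
    next
      case k: 3
      have "continuous_on UNIV (\<lambda>q :: ('a \<times> 'b) \<times> (nat \<Rightarrow> 'a \<times> 'b).
          b (fst (snd q 1)) (snd (snd q 0)) + b (fst (snd q 0)) (snd (snd q 1)))"
        by (intro cont_intros)
      then show ?thesis
        unfolding k case_prod_unfold 2 by simp
    next
      case k: 4
      show ?thesis unfolding k 3 by simp
    qed
  qed
qed

section \<open>The permutation pairing\<close>

text \<open>Defined on all matrices, a Euclidean space, so that the calculus of bounded bilinear
  maps applies. For \<open>A\<close> in \<open>so4\<close>, \<open>eps_pairing A A\<close> is 8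
  times the Pfaffian of \<open>A\<close>.\<close>

definition eps_pairing :: "real^4^4 \<Rightarrow> real^4^4 \<Rightarrow> real" where
  "eps_pairing A B = (\<Sum>\<tau> | \<tau> permutes (UNIV :: 4 set).
     of_int (sign \<tau>) * (A $ \<tau> 1 $ \<tau> 2 * B $ \<tau> 3 $ \<tau> 4))"

lemma bounded_bilinear_eps_pairing: "bounded_bilinear eps_pairing"
  by (rule bilinear_conv_bounded_bilinear[THEN iffD1])
     (auto simp: bilinear_def linear_iff eps_pairing_def
        sum.distrib sum_distrib_left algebra_simps)

text \<open>Swapping \<open>\<tau> 1\<close> with \<open>\<tau> 2\<close>, or
  \<open>\<tau> 3\<close> with \<open>\<tau> 4\<close>, flips both the sign of the permutation and
  one matrix entry, so the 24 terms fall into six groups of four equal ones.\<close>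

lemma eps_pairing_eq:
  assumes A: "A \<in> so4" and B: "B \<in> so4"
  shows "eps_pairing A B = 4 * (A$1$2 * B$3$4 - A$1$3 * B$2$4 + A$1$4 * B$2$3
    + A$2$3 * B$1$4 - A$2$4 * B$1$3 + A$3$4 * B$1$2)"
proof -
  have f1: "finite {2::4, 3, 4}" "1 \<notin> {2::4, 3, 4}" by auto
  have f2: "finite {3::4, 4}" "2 \<notin> {3::4, 4}" by auto
  have f3: "finite {4::4}" "3 \<notin> {4::4}" by auto
  have a: "A$2$1 = - A$1$2" "A$3$1 = - A$1$3" "A$4$1 = - A$1$4"
    "A$3$2 = - A$2$3" "A$4$2 = - A$2$4" "A$4$3 = - A$3$4"
    "B$2$1 = - B$1$2" "B$3$1 = - B$1$3" "B$4$1 = - B$1$4"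
    "B$3$2 = - B$2$3" "B$4$2 = - B$2$4" "B$4$3 = - B$3$4"
    using A B unfolding so4_iff by blast+
  show ?thesis
    \<comment> \<open>The images of 1, 2 and 3 are split off in turn, until only the identity on the
      singleton of 4 is left.\<close>
    unfolding eps_pairing_def UNIV_4 sum_over_permutations_insert[OF f1]
      sum_over_permutations_insert[OF f2] sum_over_permutations_insert[OF f3] permutes_sing
    by (simp add: sign_swap_id permutation_swap_id permutation_compose sign_compose, simp add: a)
qed

lemma eps_pairing_commute:
  assumes "A \<in> so4" "B \<in> so4"
  shows "eps_pairing A B = eps_pairing B A"
  using assms by (simp add: eps_pairing_eq)

text \<open>This is the invariance of the pairing under the adjoint action,
  \<open>P([A, B], C) = P(A, [B, C])\<close>, combined with symmetry. It is checked as a polynomial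
  identity in the entries above the diagonals.\<close>

lemma eps_pairing_commutator_cyclic:
  assumes "A \<in> so4" "B \<in> so4" "C \<in> so4"
  shows "eps_pairing (A ** B - B ** A) C = eps_pairing (B ** C - C ** B) A"
proof -
  have diag: "X$i$i = 0" if "X \<in> so4" for X i
    using that unfolding so4_iff by (metis equal_neg_zero)
  have lower: "X$2$1 = - X$1$2" "X$3$1 = - X$1$3" "X$4$1 = - X$1$4"
    "X$3$2 = - X$2$3" "X$4$2 = - X$2$4" "X$4$3 = - X$3$4" if "X \<in> so4" for X
    using that unfolding so4_iff by blast+
  note entries = assms[THEN diag] assms[THEN lower(1)] assms[THEN lower(2)] assms[THEN lower(3)]
    assms[THEN lower(4)] assms[THEN lower(5)] assms[THEN lower(6)]
  show ?thesis
    by (simp add: eps_pairing_eq so4_commutator assms)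
       (simp add: matrix_matrix_mult_def sum_4 entries, simp add: algebra_simps)
qed

section \<open>Calculus in the loop algebra\<close>

abbreviation loop_deriv :: "loop_so4 \<Rightarrow> real \<Rightarrow> real^4^4" where
  "loop_deriv \<xi> \<theta> \<equiv> vector_derivative (loop_val \<xi>) (at \<theta>)"

lemma smooth_curve_has_vderiv:
  assumes "smooth_curve f"
  shows "(f has_vector_derivative vector_derivative f (at \<theta>)) (at \<theta>)"
  using assms Ck_curve_SucD[of 0] unfolding smooth_curve_iff_Ck by blast

lemma smooth_curve_vderiv:
  "smooth_curve f \<Longrightarrow> smooth_curve (\<lambda>\<theta>. vector_derivative f (at \<theta>))"
  unfolding smooth_curve_iff_Ck using Ck_curve_Suc by blast

lemma smooth_curve_continuous_on: "smooth_curve f \<Longrightarrow> continuous_on S f"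
  by (meson smooth_curve_has_vderiv continuous_at_imp_continuous_on has_vector_derivative_continuous)

lemmas loop_val_has_vderiv = smooth_curve_has_vderiv[OF loop_val_smooth]

lemma continuous_on_loop_val [continuous_intros]: "continuous_on S (loop_val \<xi>)"
  by (rule smooth_curve_continuous_on[OF loop_val_smooth])

lemma continuous_on_loop_deriv [continuous_intros]: "continuous_on S (loop_deriv \<xi>)"
  by (rule smooth_curve_continuous_on[OF smooth_curve_vderiv[OF loop_val_smooth]])

text \<open>Antisymmetry is a linear condition on entries and passes to the derivative. Thus the
  symmetry and cyclicity of the pairing apply to derivatives of loops as well.\<close>

lemma loop_deriv_so4: "loop_deriv \<xi> \<theta> \<in> so4"
proof -
  have d: "((\<lambda>\<theta>. loop_val \<xi> \<theta> $ a $ b) has_vector_derivative loop_deriv \<xi> \<theta> $ a $ b) (at \<theta>)" for a b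
    using bounded_linear.has_vector_derivative[OF bounded_linear_vec_nth
        bounded_linear.has_vector_derivative[OF bounded_linear_vec_nth loop_val_has_vderiv]] .
  show ?thesis
    unfolding so4_iff
  proof (intro allI)
    fix a b
    have "(\<lambda>\<theta>. loop_val \<xi> \<theta> $ a $ b) = (\<lambda>\<theta>. - loop_val \<xi> \<theta> $ b $ a)"
      using loop_val_so4 unfolding so4_iff by blast
    with d[of a b] has_vector_derivative_minus[OF d[of b a]]
    show "loop_deriv \<xi> \<theta> $ a $ b = - loop_deriv \<xi> \<theta> $ b $ a"
      by (metis vector_derivative_unique_at)
  qed
qed

text \<open>The product rule for the bracket is grouped into the commutators of
  \<open>\<xi>'\<close> with \<open>\<eta>\<close> and of \<open>\<xi>\<close> with
  \<open>\<eta>'\<close>, the shape to which cyclicity of the pairing applies.\<close>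

lemma loop_deriv_ops:
  "loop_deriv (\<xi> + \<eta>) \<theta> = loop_deriv \<xi> \<theta> + loop_deriv \<eta> \<theta>"
  "loop_deriv (\<xi> - \<eta>) \<theta> = loop_deriv \<xi> \<theta> - loop_deriv \<eta> \<theta>"
  "loop_deriv (r *\<^sub>R \<xi>) \<theta> = r *\<^sub>R loop_deriv \<xi> \<theta>"
  "loop_deriv (lie_bracket \<xi> \<eta>) \<theta> =
     (loop_deriv \<xi> \<theta> ** loop_val \<eta> \<theta> - loop_val \<eta> \<theta> ** loop_deriv \<xi> \<theta>)
   + (loop_val \<xi> \<theta> ** loop_deriv \<eta> \<theta> - loop_deriv \<eta> \<theta> ** loop_val \<xi> \<theta>)"
proof -
  note mult = bounded_bilinear.has_vector_derivative[OF bounded_bilinear_matrix_mult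
      loop_val_has_vderiv loop_val_has_vderiv]
  show "loop_deriv (\<xi> + \<eta>) \<theta> = loop_deriv \<xi> \<theta> + loop_deriv \<eta> \<theta>"
    "loop_deriv (\<xi> - \<eta>) \<theta> = loop_deriv \<xi> \<theta> - loop_deriv \<eta> \<theta>"
    "loop_deriv (r *\<^sub>R \<xi>) \<theta> = r *\<^sub>R loop_deriv \<xi> \<theta>"
    unfolding loop_val_ops
    by (intro vector_derivative_at has_vector_derivative_add has_vector_derivative_diff
        bounded_linear.has_vector_derivative[OF bounded_linear_scaleR_right] loop_val_has_vderiv)+
  show "loop_deriv (lie_bracket \<xi> \<eta>) \<theta> =
      (loop_deriv \<xi> \<theta> ** loop_val \<eta> \<theta> - loop_val \<eta> \<theta> ** loop_deriv \<xi> \<theta>)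
    + (loop_val \<xi> \<theta> ** loop_deriv \<eta> \<theta> - loop_deriv \<eta> \<theta> ** loop_val \<xi> \<theta>)"
    unfolding loop_val_ops vector_derivative_at[OF has_vector_derivative_diff[OF mult mult]]
    by simp
qed

lemmas loop_val_apply = loop_val_ops[THEN fun_cong]

section \<open>Continuity of the cocycle\<close>

text \<open>Openness is defined by a condition at every point of a set, so that a closed ball in the
  first two orders is a neighbourhood of its centre needs an open set inside it.\<close>

lemma eventually_nhds_loop_close:
  assumes "e > 0"
  shows "\<forall>\<^sub>F \<eta> in nhds \<xi>. \<forall>\<theta>. norm (loop_val (\<eta> - \<xi>) \<theta>) \<le> e \<and> norm (loop_deriv (\<eta> - \<xi>) \<theta>) \<le> e"
proof -
  let ?d = "\<lambda>k \<eta> \<zeta> \<theta>. norm (higher_vderiv k (loop_val \<eta>) \<theta> - higher_vderiv k (loop_val \<zeta>) \<theta>)"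
  \<comment> \<open>A bound \<open>d\<close>, uniform in the angle and strictly below
    \<open>e\<close>, leaves the room \<open>e - d\<close>; a ball of half that radius around a
    member stays within the bound \<open>(e + d) / 2 < e\<close>.\<close>
  let ?U = "{\<eta>. \<exists>d<e. \<forall>k\<le>1. \<forall>\<theta>. ?d k \<eta> \<xi> \<theta> \<le> d}"
  have "open ?U"
    unfolding open_loop_so4_def
  proof
    fix \<eta> assume "\<eta> \<in> ?U"
    then obtain d where d: "d < e" "\<forall>k\<le>1. \<forall>\<theta>. ?d k \<eta> \<xi> \<theta> \<le> d" by blast
    have "\<zeta> \<in> ?U" if "\<forall>k\<le>1. \<forall>\<theta>. ?d k \<zeta> \<eta> \<theta> \<le> (e - d) / 2" for \<zeta>
    proof -
      have "?d k \<zeta> \<xi> \<theta> \<le> (e + d) / 2" if "k \<le> 1" for k \<theta>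
      proof -
        have "?d k \<zeta> \<xi> \<theta> \<le> ?d k \<zeta> \<eta> \<theta> + ?d k \<eta> \<xi> \<theta>"
          by (rule norm_diff_triangle_le[OF order_refl order_refl])
        also have "\<dots> \<le> (e - d) / 2 + d"
          using d(2) that \<open>\<forall>k\<le>1. \<forall>\<theta>. ?d k \<zeta> \<eta> \<theta> \<le> (e - d) / 2\<close> by (intro add_mono) auto
        finally show ?thesis by (simp add: field_simps)
      qed
      moreover have "(e + d) / 2 < e" using d(1) by simp
      ultimately show ?thesis by blast
    qed
    moreover have "(e - d) / 2 > 0" using d(1) by simp
    ultimately show "\<exists>n. \<exists>e>0. \<forall>\<zeta>. (\<forall>k\<le>n. \<forall>\<theta>. ?d k \<zeta> \<eta> \<theta> \<le> e) \<longrightarrow> \<zeta> \<in> ?U"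
      by blast
  qed
  moreover have "\<xi> \<in> ?U" using assms by auto
  ultimately show ?thesis
    unfolding eventually_nhds
  proof (intro exI[of _ ?U] conjI ballI allI)
    fix \<eta> \<theta> assume "\<eta> \<in> ?U"
    then obtain d where "d < e" "\<forall>k\<le>1. \<forall>\<theta>. ?d k \<eta> \<xi> \<theta> \<le> d" by blast
    then have "?d k \<eta> \<xi> \<theta> \<le> e" if "k \<le> 1" for k
      using that by (meson less_imp_le order_trans)
    from this[of 0] this[of "Suc 0"]
    show "norm (loop_val (\<eta> - \<xi>) \<theta>) \<le> e" "norm (loop_deriv (\<eta> - \<xi>) \<theta>) \<le> e"
      unfolding higher_vderiv_Suc higher_vderiv_0 by (simp_all add: loop_deriv_ops loop_val_apply)
  qed auto
qed

lemma loop_bounded: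
  obtains M where "M \<ge> 0" "\<And>\<theta>. \<theta> \<in> {0..1} \<Longrightarrow> norm (loop_val \<xi> \<theta>) \<le> M"
    "\<And>\<theta>. \<theta> \<in> {0..1} \<Longrightarrow> norm (loop_deriv \<xi> \<theta>) \<le> M"
proof -
  have *: "\<exists>M. \<forall>\<theta>\<in>{0..1::real}. norm (f \<theta>) \<le> M" if "continuous_on {0..1} f" for f :: "real \<Rightarrow> real^4^4"
    using compact_imp_bounded[OF compact_continuous_image[OF that compact_Icc]]
    by (auto simp: bounded_iff)
  obtain M N where "\<forall>\<theta>\<in>{0..1}. norm (loop_val \<xi> \<theta>) \<le> M" "\<forall>\<theta>\<in>{0..1}. norm (loop_deriv \<xi> \<theta>) \<le> N"
    using *[OF continuous_on_loop_val] *[OF continuous_on_loop_deriv] by metis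
  then show ?thesis
    by (intro that[of "max 0 (max M N)"]) (auto simp: le_max_iff_disj)
qed

text \<open>The map of the theorem without its constant and with the signed sum under the integral.
  The integrand is skew, so vanishing on the diagonal is immediate.\<close>

definition loop_form :: "loop_so4 \<Rightarrow> loop_so4 \<Rightarrow> real" where
  "loop_form \<xi> \<eta> = integral {0..1} (\<lambda>\<theta>. eps_pairing (loop_deriv \<xi> \<theta>) (loop_val \<eta> \<theta>)
     - eps_pairing (loop_deriv \<eta> \<theta>) (loop_val \<xi> \<theta>))"

lemma loop_form_has_integral:
  "((\<lambda>\<theta>. eps_pairing (loop_deriv \<xi> \<theta>) (loop_val \<eta> \<theta>)
     - eps_pairing (loop_deriv \<eta> \<theta>) (loop_val \<xi> \<theta>)) has_integral loop_form \<xi> \<eta>) {0..1}"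
  unfolding loop_form_def
  by (intro integrable_integral integrable_continuous_real continuous_intros
      bounded_bilinear.continuous_on[OF bounded_bilinear_eps_pairing])

text \<open>Each summand is continuous, hence integrable, so the finite sum and the integral
  commute. Read from right to left, this brings the statement of the theorem to
  \<open>loop_form\<close>.\<close>

lemma loop_form_eq_sum:
  "loop_form \<xi> \<eta> = (\<Sum>\<tau> | \<tau> permutes (UNIV :: 4 set). of_int (sign \<tau>) *
     integral {0..1} (\<lambda>\<theta>. loop_deriv \<xi> \<theta> $ \<tau> 1 $ \<tau> 2 * loop_val \<eta> \<theta> $ \<tau> 3 $ \<tau> 4
       - loop_deriv \<eta> \<theta> $ \<tau> 1 $ \<tau> 2 * loop_val \<xi> \<theta> $ \<tau> 3 $ \<tau> 4))"
proof -
  let ?g = "\<lambda>\<tau> \<theta>. loop_deriv \<xi> \<theta> $ \<tau> 1 $ \<tau> 2 * loop_val \<eta> \<theta> $ \<tau> 3 $ \<tau> 4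
       - loop_deriv \<eta> \<theta> $ \<tau> 1 $ \<tau> 2 * loop_val \<xi> \<theta> $ \<tau> 3 $ \<tau> 4"
  have "?g \<tau> integrable_on {0..1}" for \<tau> :: "4 \<Rightarrow> 4"
    by (intro integrable_continuous_real continuous_intros)
  then have "((\<lambda>\<theta>. \<Sum>\<tau> | \<tau> permutes (UNIV :: 4 set). of_int (sign \<tau>) * ?g \<tau> \<theta>) has_integral
      (\<Sum>\<tau> | \<tau> permutes (UNIV :: 4 set). of_int (sign \<tau>) * integral {0..1} (?g \<tau>))) {0..1}"
    by (intro has_integral_sum has_integral_mult_right integrable_integral) (auto simp: finite_permutations)
  then show ?thesis
    unfolding loop_form_def eps_pairing_def
    by (intro integral_unique) (simp add: sum_subtractf[symmetric] right_diff_distrib)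
qed

lemma bilinear_loop_form: "bilinear loop_form"
proof -
  note bb = bounded_bilinear_eps_pairing
  note simps = loop_val_apply loop_deriv_ops bounded_bilinear.add_left[OF bb] bounded_bilinear.add_right[OF bb]
    bounded_bilinear.scaleR_left[OF bb] bounded_bilinear.scaleR_right[OF bb]
  have add: "loop_form (x + x') y = loop_form x y + loop_form x' y" for x x' y
    unfolding loop_form_def[of "x + x'"]
    by (rule integral_unique, rule has_integral_eq[rotated],
        rule has_integral_add[OF loop_form_has_integral loop_form_has_integral]) (simp add: simps)
  have scale: "loop_form (r *\<^sub>R x) y = r *\<^sub>R loop_form x y" for r x y
    unfolding loop_form_def[of "r *\<^sub>R x"]
    by (rule integral_unique, rule has_integral_eq[rotated],
        rule has_integral_cmul[OF loop_form_has_integral]) (simp add: simps algebra_simps)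
  \<comment> \<open>Skew symmetry transfers linearity from the first argument to the second.\<close>
  have skew: "loop_form x y = - loop_form y x" for x y
    unfolding loop_form_def[of x y]
    by (rule integral_unique, rule has_integral_eq[rotated],
        rule has_integral_neg[OF loop_form_has_integral]) simp
  have "linear (\<lambda>x. loop_form x y)" for y
    by (simp add: linear_iff add scale)
  moreover have "linear (loop_form x)" for x
    by (simp add: linear_iff skew[of x] add scale)
  ultimately show ?thesis by (simp add: bilinear_def)
qed

text \<open>An estimate by the \<open>C\<^sup>1\<close> sizes of both loops over one period, with
  arbitrary bounds \<open>M\<close> and \<open>N\<close> in place of suprema.\<close>

lemma loop_form_bound:
  obtains C where "C \<ge> 0" "\<And>\<xi> \<eta> M N. \<lbrakk>M \<ge> 0; N \<ge> 0;
      \<And>\<theta>. \<theta> \<in> {0..1} \<Longrightarrow> norm (loop_val \<xi> \<theta>) \<le> M \<and> norm (loop_deriv \<xi> \<theta>) \<le> M;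
      \<And>\<theta>. \<theta> \<in> {0..1} \<Longrightarrow> norm (loop_val \<eta> \<theta>) \<le> N \<and> norm (loop_deriv \<eta> \<theta>) \<le> N\<rbrakk>
    \<Longrightarrow> \<bar>loop_form \<xi> \<eta>\<bar> \<le> C * M * N"
proof -
  obtain K where K: "K \<ge> 0" "\<And>A B. \<bar>eps_pairing A B\<bar> \<le> norm A * norm B * K"
    using bounded_bilinear.nonneg_bounded[OF bounded_bilinear_eps_pairing] by auto
  show ?thesis
  \<comment> \<open>The integrand is a difference of two pairings, each at most
    \<open>K * M * N\<close>, over an interval of length 1.\<close>
  proof (rule that[of "2 * K"])
    fix \<xi> \<eta> :: loop_so4 and M N :: real
    assume M: "M \<ge> 0" "N \<ge> 0"
      and x: "\<And>\<theta>. \<theta> \<in> {0..1} \<Longrightarrow> norm (loop_val \<xi> \<theta>) \<le> M \<and> norm (loop_deriv \<xi> \<theta>) \<le> M"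
      and y: "\<And>\<theta>. \<theta> \<in> {0..1} \<Longrightarrow> norm (loop_val \<eta> \<theta>) \<le> N \<and> norm (loop_deriv \<eta> \<theta>) \<le> N"
    have *: "\<bar>eps_pairing A B\<bar> \<le> K * a * b" if "norm A \<le> a" "norm B \<le> b" for A B a b
    proof -
      have "norm A * norm B \<le> a * b"
        using that by (meson mult_mono norm_ge_zero order_trans)
      then have "norm A * norm B * K \<le> a * b * K" using K(1) by (rule mult_right_mono)
      with K(2)[of A B] show ?thesis by (simp add: mult_ac)
    qed
    have "norm (loop_form \<xi> \<eta>) \<le> (2 * K * M * N) * measure lborel {0..1::real}"
    proof (rule has_integral_bound_real[OF _ finite.emptyI loop_form_has_integral], goal_cases)
      case (2 \<theta>)
      then have "\<bar>eps_pairing (loop_deriv \<xi> \<theta>) (loop_val \<eta> \<theta>)\<bar> \<le> K * M * N"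
        "\<bar>eps_pairing (loop_deriv \<eta> \<theta>) (loop_val \<xi> \<theta>)\<bar> \<le> K * N * M"
        using x y by (auto intro!: *)
      then show ?case by (simp add: mult_ac)
    qed (use K M in simp)
    then show "\<bar>loop_form \<xi> \<eta>\<bar> \<le> 2 * K * M * N" by simp
  qed (use K in simp)
qed

lemma continuous_on_loop_form: "continuous_on UNIV (\<lambda>(\<xi>, \<eta>). loop_form \<xi> \<eta>)"
proof -
  obtain C where C: "C \<ge> 0" "\<And>\<xi> \<eta> M N. \<lbrakk>M \<ge> 0; N \<ge> 0;
      \<And>\<theta>. \<theta> \<in> {0..1} \<Longrightarrow> norm (loop_val \<xi> \<theta>) \<le> M \<and> norm (loop_deriv \<xi> \<theta>) \<le> M;
      \<And>\<theta>. \<theta> \<in> {0..1} \<Longrightarrow> norm (loop_val \<eta> \<theta>) \<le> N \<and> norm (loop_deriv \<eta> \<theta>) \<le> N\<rbrakk>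
    \<Longrightarrow> \<bar>loop_form \<xi> \<eta>\<bar> \<le> C * M * N"
    by (rule loop_form_bound) blast
  have "((\<lambda>(\<xi>, \<eta>). loop_form \<xi> \<eta>) \<longlongrightarrow> loop_form x y) (nhds x \<times>\<^sub>F nhds y)" for x y
  proof (rule tendstoI)
    fix e :: real assume "e > 0"
    obtain M where M: "M \<ge> 0" "\<And>\<theta>. \<theta> \<in> {0..1} \<Longrightarrow> norm (loop_val x \<theta>) \<le> M"
      "\<And>\<theta>. \<theta> \<in> {0..1} \<Longrightarrow> norm (loop_deriv x \<theta>) \<le> M" by (rule loop_bounded) blast
    obtain N where N: "N \<ge> 0" "\<And>\<theta>. \<theta> \<in> {0..1} \<Longrightarrow> norm (loop_val y \<theta>) \<le> N"
      "\<And>\<theta>. \<theta> \<in> {0..1} \<Longrightarrow> norm (loop_deriv y \<theta>) \<le> N" by (rule loop_bounded) blast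
    \<comment> \<open>The three summands bound the terms of the bilinear expansion around
      \<open>(x, y)\<close> for increments of \<open>C\<^sup>1\<close> size at most
      \<open>d\<close>; they tend to 0, which supplies a suitable positive \<open>d\<close>.\<close>
    have "((\<lambda>d. C * d * d + C * d * N + C * M * d) \<longlongrightarrow> C * 0 * 0 + C * 0 * N + C * M * 0) (at_right 0)"
      by (intro tendsto_intros)
    then have "\<forall>\<^sub>F d in at_right 0. C * d * d + C * d * N + C * M * d < e"
      using \<open>e > 0\<close> by (intro order_tendstoD(2)) auto
    then have "\<forall>\<^sub>F d in at_right 0. C * d * d + C * d * N + C * M * d < e \<and> 0 < d"
      by (intro eventually_conj) (auto simp: eventually_at_right_less)
    then obtain d where d: "C * d * d + C * d * N + C * M * d < e" "d > 0"
      using eventually_happens'[OF trivial_limit_at_right_real] by blast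
    show "\<forall>\<^sub>F p in nhds x \<times>\<^sub>F nhds y. dist ((\<lambda>(\<xi>, \<eta>). loop_form \<xi> \<eta>) p) (loop_form x y) < e"
    proof (rule eventually_mono[OF eventually_prodI[OF
          eventually_nhds_loop_close[OF d(2), of x] eventually_nhds_loop_close[OF d(2), of y]]])
      fix p :: "loop_so4 \<times> loop_so4"
      assume p: "(\<forall>\<theta>. norm (loop_val (fst p - x) \<theta>) \<le> d \<and> norm (loop_deriv (fst p - x) \<theta>) \<le> d) \<and>
        (\<forall>\<theta>. norm (loop_val (snd p - y) \<theta>) \<le> d \<and> norm (loop_deriv (snd p - y) \<theta>) \<le> d)"
      define u v where "u = fst p - x" and "v = snd p - y"
      have "loop_form (fst p) (snd p) = loop_form (u + x) (v + y)"
        by (simp add: u_def v_def)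
      also have "\<dots> = loop_form u v + loop_form u y + loop_form x v + loop_form x y"
        by (simp add: bilinear_ladd[OF bilinear_loop_form] bilinear_radd[OF bilinear_loop_form])
      finally have "loop_form (fst p) (snd p) - loop_form x y = loop_form u v + loop_form u y + loop_form x v"
        by simp
      moreover have "\<bar>loop_form u v\<bar> \<le> C * d * d" "\<bar>loop_form u y\<bar> \<le> C * d * N" "\<bar>loop_form x v\<bar> \<le> C * M * d"
        using p M N d by (auto intro!: C(2) simp: u_def v_def)
      ultimately have "\<bar>loop_form (fst p) (snd p) - loop_form x y\<bar> < e"
        using d(1) by linarith
      then show "dist ((\<lambda>(\<xi>, \<eta>). loop_form \<xi> \<eta>) p) (loop_form x y) < e"
        by (simp add: case_prod_unfold dist_real_def)
    qed
  qed
  \<comment> \<open>The limit was taken along the full neighbourhood filter of the point, which is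
    coarser than the punctured one in \<open>continuous_on\<close>.\<close>
  then show ?thesis
    unfolding continuous_on_def
    by (auto intro: tendsto_mono[OF at_within_le_nhds[of "(_, _)", unfolded nhds_prod]])
qed

section \<open>The cocycle identity\<close>

lemma loop_form_cocycle:
  "loop_form (lie_bracket x y) z + loop_form (lie_bracket y z) x + loop_form (lie_bracket z x) y = 0"
proof -
  note bb = bounded_bilinear_eps_pairing
  let ?T = "\<lambda>A B C. eps_pairing (A ** B - B ** A) C"
  let ?F = "\<lambda>\<theta>. eps_pairing (loop_val (lie_bracket x y) \<theta>) (loop_val z \<theta>)"
  let ?F' = "\<lambda>\<theta>. eps_pairing (loop_val (lie_bracket x y) \<theta>) (loop_deriv z \<theta>)
     + eps_pairing (loop_deriv (lie_bracket x y) \<theta>) (loop_val z \<theta>)"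
  let ?I = "\<lambda>\<xi> \<eta> \<theta>. eps_pairing (loop_deriv \<xi> \<theta>) (loop_val \<eta> \<theta>)
     - eps_pairing (loop_deriv \<eta> \<theta>) (loop_val \<xi> \<theta>)"
  have "(?F has_vector_derivative ?F' \<theta>) (at \<theta>)" for \<theta>
    by (rule bounded_bilinear.has_vector_derivative[OF bb loop_val_has_vderiv loop_val_has_vderiv])
  then have "(?F' has_integral ?F 1 - ?F 0) {0..1}"
    by (intro fundamental_theorem_of_calculus)
       (auto intro: has_vector_derivative_at_within)
  moreover have "?F 1 = ?F 0"
    using loop_val_period[of _ 0] by simp
  ultimately have "(?F' has_integral 0) {0..1}" by simp
  moreover have "?F' \<theta> = ?I (lie_bracket x y) z \<theta> + ?I (lie_bracket y z) x \<theta> + ?I (lie_bracket z x) y \<theta>" for \<theta>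
  proof -
    \<comment> \<open>The product rule gives the first two terms; symmetry of the pairing moves
      \<open>loop_deriv c\<close> to the last slot in the third.\<close>
    have I: "?I (lie_bracket a b) c \<theta> = ?T (loop_deriv a \<theta>) (loop_val b \<theta>) (loop_val c \<theta>)
       + ?T (loop_val a \<theta>) (loop_deriv b \<theta>) (loop_val c \<theta>)
       - ?T (loop_val a \<theta>) (loop_val b \<theta>) (loop_deriv c \<theta>)" for a b c
      by (simp add: loop_deriv_ops bounded_bilinear.add_left[OF bb] loop_val_apply
          eps_pairing_commute[OF loop_deriv_so4] so4_commutator loop_val_so4)
    have c: "?T A B C = ?T C A B" "?T A B C = ?T B C A"
      if "A \<in> so4" "B \<in> so4" "C \<in> so4" for A B C
      using that eps_pairing_commutator_cyclic by metis+
    show ?thesis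
      unfolding I
      \<comment> \<open>Of the nine terms, three differentiate any given loop among
        \<open>x\<close>, \<open>y\<close> and \<open>z\<close>. Cyclicity makes these three equal
        up to sign, with signs adding up to \<open>1 + 1 - 1 = 1\<close>, which leaves the
        corresponding term of \<open>?F'\<close>.\<close>
      using c[of "loop_deriv x \<theta>" "loop_val y \<theta>" "loop_val z \<theta>"]
        c[of "loop_val x \<theta>" "loop_deriv y \<theta>" "loop_val z \<theta>"]
        c[of "loop_val x \<theta>" "loop_val y \<theta>" "loop_deriv z \<theta>"]
      by (simp add: loop_deriv_so4 loop_val_so4 loop_deriv_ops loop_val_apply
          bounded_bilinear.add_left[OF bb])
  qed
  moreover have "((\<lambda>\<theta>. ?I (lie_bracket x y) z \<theta> + ?I (lie_bracket y z) x \<theta> + ?I (lie_bracket z x) y \<theta>)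
      has_integral loop_form (lie_bracket x y) z + loop_form (lie_bracket y z) x + loop_form (lie_bracket z x) y) {0..1}"
    by (intro has_integral_add loop_form_has_integral)
  ultimately show ?thesis
    by (metis (no_types, lifting) has_integral_unique ext)
qed

text \<open>The cocycle conditions survive scaling, so the normalisation in the theorem can be an
  arbitrary constant \<open>c\<close>.\<close>

lemma lie_2_cocycle_scaled_loop_form: "lie_2_cocycle (\<lambda>\<xi> \<eta>. c * loop_form \<xi> \<eta>)"
proof -
  have b: "bilinear (\<lambda>\<xi> \<eta>. c * loop_form \<xi> \<eta>)"
    using bilinear_loop_form
    by (auto simp: bilinear_def linear_iff algebra_simps)
  have "continuous_on UNIV (\<lambda>(\<xi>, \<eta>). c * loop_form \<xi> \<eta>)"
    using continuous_on_mult_left[OF continuous_on_loop_form, of c] by (simp add: case_prod_unfold)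
  moreover have "loop_form x x = 0" for x
    by (simp add: loop_form_def)
  ultimately show ?thesis
    unfolding lie_2_cocycle_def
    using smooth_map_bilinear[OF b] b loop_form_cocycle
    by (simp flip: distrib_left)
qed

theorem theorem5p1:
  shows "lie_2_cocycle (\<lambda>\<xi>\<^sub>1 \<xi>\<^sub>2 :: loop_so4.
    -1 / (128 * pi^2) *
      (\<Sum>\<tau> | \<tau> permutes (UNIV :: 4 set).
         of_int (sign \<tau>) *
         integral {0..1} (\<lambda>\<theta>.
           vector_derivative (loop_val \<xi>\<^sub>1) (at \<theta>) $ \<tau> 1 $ \<tau> 2 * loop_val \<xi>\<^sub>2 \<theta> $ \<tau> 3 $ \<tau> 4
         - vector_derivative (loop_val \<xi>\<^sub>2) (at \<theta>) $ \<tau> 1 $ \<tau> 2 * loop_val \<xi>\<^sub>1 \<theta> $ \<tau> 3 $ \<tau> 4)))"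
  unfolding loop_form_eq_sum[symmetric] by (rule lie_2_cocycle_scaled_loop_form)

end
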